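(* Let $\gamma:\mathbb{R}/\ell\mathbb{Z}\to\mathbb{R}^2$, $\gamma(s)=c+r(\cos(s/r),\sin(s/r))$, be the arclength parametrization of a circle of radius $r>0$ and center $c$ in the plane, where $\ell=2\pi r$. There is no locally arclength preserving (infinitesimal) motion of the circle that increases any antipodal distance to first order without decreasing some other one; that is, if $V:\mathbb{R}/\ell\mathbb{Z}\to\mathbb{R}^2$ is a locally arclength preserving variation and $$\bigl(V(s_0)-V(s_0+\pi r)\bigr)\cdot\bigl(\gamma(s_0)-\gamma(s_0+\pi r)\bigr)>0$$ for some $s_0$, then there is $s_1$ with $$\bigl(V(s_1)-V(s_1+\pi r)\bigr)\cdot\bigl(\gamma(s_1)-\gamma(s_1+\pi r)\bigr)<0.$$
   Context: A locally arclength preserving variation of $\gamma$ is an absolutely continuous map $V:\mathbb{R}/\ell\mathbb{Z}\to\mathbb{R}^2$ (equivalently, an absolutely continuous $V:[0,\ell]\to\mathbb{R}^2$ with $V(0)=V(\ell)$) such that $V'(s)\cdot\gamma'(s)=0$ for almost every $s$. The expression $(V(s)-V(t))\cdot(\gamma(s)-\gamma(t))$ is, up to a positive factor, the first-order rate of change of the distance between $\gamma(s)$ and $\gamma(t)$ under $V$. *)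

theory Defs
  imports "HOL-Analysis.Analysis"
begin

text \<open>
  Absolute continuity in the usual \<open>\<epsilon>\<close>-\<open>\<delta>\<close> sense. A division \<open>\<D>\<close> of some \<open>T \<subseteq> S\<close> is precisely a
  finite family of pairwise non-overlapping nonempty compact intervals \<open>K = [Inf K, Sup K]\<close>
  contained in \<open>S\<close>; degenerate intervals contribute \<open>0\<close> to both sums.
\<close>
definition absolutely_continuous_on :: "real set \<Rightarrow> (real \<Rightarrow> 'a::real_normed_vector) \<Rightarrow> bool" where
  "absolutely_continuous_on S f \<longleftrightarrow>
    (\<forall>\<epsilon>>0. \<exists>\<delta>>0. \<forall>\<D> T. \<D> division_of T \<and> T \<subseteq> S \<and> (\<Sum>K\<in>\<D>. Sup K - Inf K) < \<delta>
       \<longrightarrow> (\<Sum>K\<in>\<D>. norm (f (Sup K) - f (Inf K))) < \<epsilon>)"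

text \<open>
  Maps on \<open>\<real>/L\<int>\<close> are represented by \<open>L\<close>-periodic maps on \<open>\<real>\<close>. The last condition reads
  \<open>V'(s) \<bullet> \<gamma>'(s) = 0\<close> for almost every \<open>s\<close>, the derivatives being required to exist at those \<open>s\<close>.
  For absolutely continuous \<open>V\<close> and Lipschitz \<open>\<gamma>\<close> they exist almost everywhere anyway.
\<close>
definition locally_arclength_preserving_variation ::
  "real \<Rightarrow> (real \<Rightarrow> real^2) \<Rightarrow> (real \<Rightarrow> real^2) \<Rightarrow> bool" where
  "locally_arclength_preserving_variation L \<gamma> V \<longleftrightarrow>
     (\<forall>s. V (s + L) = V s) \<and>
     absolutely_continuous_on {0..L} V \<and>
     (AE s in lebesgue. \<exists>v g. (V has_vector_derivative v) (at s) \<and>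
        (\<gamma> has_vector_derivative g) (at s) \<and> v \<bullet> g = 0)"

definition circle_arclength :: "real^2 \<Rightarrow> real \<Rightarrow> real \<Rightarrow> real^2" where
  "circle_arclength c r s = c + r *\<^sub>R vector [cos (s / r), sin (s / r)]"

end

theory Submission
  imports Defs
begin

text \<open>
  Write \<open>n\<close> for the outer unit normal. Since antipodal normals are opposite, the quantity
  \<open>(V s - V (s + \<pi> r)) \<bullet> (\<gamma> s - \<gamma> (s + \<pi> r))\<close> equals \<open>2 r (V \<bullet> n)(s) + 2 r (V \<bullet> n)(s + \<pi> r)\<close>,
  so its mean over a half period is a multiple of the mean of \<open>V \<bullet> n\<close> over the circle. The latter
  is zero by integration by parts, \<open>n\<close> being proportional to \<open>\<gamma>''\<close> and \<open>V' \<bullet> \<gamma>'\<close> being zero almost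
  everywhere. A continuous function of mean zero that is positive somewhere is negative somewhere.
\<close>

section \<open>Absolute continuity on a compact interval\<close>

lemma division_of_real_bounds:
  fixes \<D> :: "real set set"
  assumes "\<D> division_of T" "K \<in> \<D>"
  shows "Inf K \<in> K" "Sup K \<in> K" "Inf K \<le> Sup K" "K = {Inf K..Sup K}" 
proof -
  obtain u v where "K = cbox u v" "K \<noteq> {}"
    using division_ofD(3,4)[OF assms] by blast
  then show "Inf K \<in> K" "Sup K \<in> K" "Inf K \<le> Sup K" "K = {Inf K..Sup K}"
    by auto
qed

lemma absolutely_continuous_onE:
  assumes "absolutely_continuous_on S f" "0 < \<epsilon>"
  obtains \<delta> where "0 < \<delta>"
    "\<And>\<D> T. \<lbrakk>\<D> division_of T; T \<subseteq> S; (\<Sum>K\<in>\<D>. Sup K - Inf K) < \<delta>\<rbrakk>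
      \<Longrightarrow> (\<Sum>K\<in>\<D>. norm (f (Sup K) - f (Inf K))) < \<epsilon>"
  using assms unfolding absolutely_continuous_on_def by metis

lemma absolutely_continuous_on_imp_continuous_on:
  assumes ac: "absolutely_continuous_on {a..b} f"
  shows "continuous_on {a..b} f"
  unfolding continuous_on_iff
proof (intro ballI allI impI)
  fix x \<epsilon> :: real
  assume x: "x \<in> {a..b}" and "0 < \<epsilon>"
  then obtain \<delta> where \<delta>: "0 < \<delta>"
    "\<And>\<D> T. \<lbrakk>\<D> division_of T; T \<subseteq> {a..b}; (\<Sum>K\<in>\<D>. Sup K - Inf K) < \<delta>\<rbrakk>
      \<Longrightarrow> (\<Sum>K\<in>\<D>. norm (f (Sup K) - f (Inf K))) < \<epsilon>"
    using absolutely_continuous_onE[OF ac] by metis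
  have small: "norm (f v - f u) < \<epsilon>" if "u \<le> v" "u \<in> {a..b}" "v \<in> {a..b}" "v - u < \<delta>" for u v
  proof -
    \<comment> \<open>A single interval already forms a division, so absolute continuity bounds one
      increment. The division needs its endpoints in order, whence the case split on
      \<open>x \<le> y\<close> afterwards.\<close>
    have "{{u..v}} division_of {u..v}"
      using that(1) division_of_self[of u v] by simp
    then show ?thesis
      using \<delta>(2)[of "{{u..v}}" "{u..v}"] that by auto
  qed
  have "dist (f y) (f x) < \<epsilon>" if "y \<in> {a..b}" "dist y x < \<delta>" for y
    using small[of x y] small[of y x] that x
    by (cases "x \<le> y") (auto simp: dist_norm norm_minus_commute)
  then show "\<exists>d>0. \<forall>y\<in>{a..b}. dist y x < d \<longrightarrow> dist (f y) (f x) < \<epsilon>"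
    using \<delta>(1) by blast
qed

lemma lipschitz_on_imp_absolutely_continuous_on:
  assumes "C-lipschitz_on S f"
  shows "absolutely_continuous_on S f"
  unfolding absolutely_continuous_on_def
proof (intro allI impI)
  fix \<epsilon> :: real assume "0 < \<epsilon>"
  have "0 \<le> C" using assms lipschitz_on_nonneg by blast
  \<comment> \<open>Using \<open>C + 1\<close> instead of \<open>C\<close> keeps the threshold
    \<open>\<epsilon> / (C + 1)\<close> positive when \<open>C\<close> is zero.\<close>
  have "(\<Sum>K\<in>\<D>. norm (f (Sup K) - f (Inf K))) < \<epsilon>"
    if div: "\<D> division_of T" and "T \<subseteq> S" and small: "(\<Sum>K\<in>\<D>. Sup K - Inf K) < \<epsilon> / (C + 1)" for \<D> T
  proof -
    have "norm (f (Sup K) - f (Inf K)) \<le> (C + 1) * (Sup K - Inf K)" if "K \<in> \<D>" for K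
    proof -
      note K = division_of_real_bounds[OF div that]
      have "K \<subseteq> S" using division_ofD(2)[OF div that] \<open>T \<subseteq> S\<close> by blast
      then have "norm (f (Sup K) - f (Inf K)) \<le> C * (Sup K - Inf K)"
        using lipschitz_onD[OF assms, of "Sup K" "Inf K"] K by (auto simp: dist_norm)
      also have "\<dots> \<le> (C + 1) * (Sup K - Inf K)"
        using K(3) by (intro mult_right_mono) auto
      finally show ?thesis .
    qed
    then have "(\<Sum>K\<in>\<D>. norm (f (Sup K) - f (Inf K))) \<le> (C + 1) * (\<Sum>K\<in>\<D>. Sup K - Inf K)"
      by (simp add: sum_distrib_left sum_mono)
    also have "\<dots> < \<epsilon>"
      using small \<open>0 \<le> C\<close> by (simp add: field_simps)
    finally show ?thesis .
  qed
  then show "\<exists>\<delta>>0. \<forall>\<D> T. \<D> division_of T \<and> T \<subseteq> S \<and> (\<Sum>K\<in>\<D>. Sup K - Inf K) < \<delta>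
       \<longrightarrow> (\<Sum>K\<in>\<D>. norm (f (Sup K) - f (Inf K))) < \<epsilon>"
    using \<open>0 < \<epsilon>\<close> \<open>0 \<le> C\<close> by (intro exI[of _ "\<epsilon> / (C + 1)"]) auto
qed

text \<open>Both factors are continuous on a compact interval, hence bounded. Splitting an increment
  of the product as in the product rule then bounds it by the increments of the factors, each
  weighted by the bound of the other.\<close>

lemma absolutely_continuous_on_inner:
  fixes f g :: "real \<Rightarrow> 'a::real_inner"
  assumes f: "absolutely_continuous_on {a..b} f" and g: "absolutely_continuous_on {a..b} g"
  shows "absolutely_continuous_on {a..b} (\<lambda>x. f x \<bullet> g x)"
  unfolding absolutely_continuous_on_def
proof (intro allI impI)
  fix \<epsilon> :: real assume "0 < \<epsilon>"
  have "bounded (f ` {a..b})" "bounded (g ` {a..b})"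
    using f g absolutely_continuous_on_imp_continuous_on compact_continuous_image compact_imp_bounded
    by blast+
  then obtain A B where A: "0 < A" "\<And>x. x \<in> {a..b} \<Longrightarrow> norm (f x) \<le> A"
    and B: "0 < B" "\<And>x. x \<in> {a..b} \<Longrightarrow> norm (g x) \<le> B"
    unfolding bounded_pos by blast
  \<comment> \<open>Increments of \<open>f\<close> will be multiplied by the bound \<open>B\<close>
    of \<open>g\<close>, and those of \<open>g\<close> by the bound \<open>A\<close> of
    \<open>f\<close>; the tolerances are chosen so that each product contributes
    \<open>\<epsilon> / 2\<close>.\<close>
  obtain \<delta> where \<delta>: "0 < \<delta>"
    "\<And>\<D> T. \<lbrakk>\<D> division_of T; T \<subseteq> {a..b}; (\<Sum>K\<in>\<D>. Sup K - Inf K) < \<delta>\<rbrakk>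
      \<Longrightarrow> (\<Sum>K\<in>\<D>. norm (f (Sup K) - f (Inf K))) < \<epsilon> / (2 * B)"
    by (rule absolutely_continuous_onE[OF f, of "\<epsilon> / (2 * B)"]) (use \<open>0 < \<epsilon>\<close> B(1) in auto)
  obtain \<delta>' where \<delta>': "0 < \<delta>'"
    "\<And>\<D> T. \<lbrakk>\<D> division_of T; T \<subseteq> {a..b}; (\<Sum>K\<in>\<D>. Sup K - Inf K) < \<delta>'\<rbrakk>
      \<Longrightarrow> (\<Sum>K\<in>\<D>. norm (g (Sup K) - g (Inf K))) < \<epsilon> / (2 * A)"
    by (rule absolutely_continuous_onE[OF g, of "\<epsilon> / (2 * A)"]) (use \<open>0 < \<epsilon>\<close> A(1) in auto)
  have "(\<Sum>K\<in>\<D>. norm (f (Sup K) \<bullet> g (Sup K) - f (Inf K) \<bullet> g (Inf K))) < \<epsilon>"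
    if div: "\<D> division_of T" and T: "T \<subseteq> {a..b}"
      and small: "(\<Sum>K\<in>\<D>. Sup K - Inf K) < min \<delta> \<delta>'" for \<D> T
  proof -
    have "norm (f (Sup K) \<bullet> g (Sup K) - f (Inf K) \<bullet> g (Inf K))
        \<le> B * norm (f (Sup K) - f (Inf K)) + A * norm (g (Sup K) - g (Inf K))" if "K \<in> \<D>" for K
    proof -
      have "K \<subseteq> {a..b}" using division_ofD(2)[OF div that] T by blast
      then have K: "Inf K \<in> {a..b}" "Sup K \<in> {a..b}"
        using division_of_real_bounds[OF div that] by blast+
      have "f (Sup K) \<bullet> g (Sup K) - f (Inf K) \<bullet> g (Inf K)
          = (f (Sup K) - f (Inf K)) \<bullet> g (Sup K) + f (Inf K) \<bullet> (g (Sup K) - g (Inf K))"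
        by (simp add: inner_diff_left inner_diff_right)
      also have "norm \<dots> \<le> norm (f (Sup K) - f (Inf K)) * norm (g (Sup K))
          + norm (f (Inf K)) * norm (g (Sup K) - g (Inf K))"
        by (intro norm_triangle_mono) (simp_all add: Cauchy_Schwarz_ineq2)
      also have "\<dots> \<le> norm (f (Sup K) - f (Inf K)) * B + A * norm (g (Sup K) - g (Inf K))"
        using A B K by (intro add_mono mult_left_mono mult_right_mono) auto
      finally show ?thesis by (simp add: mult.commute)
    qed
    then have "(\<Sum>K\<in>\<D>. norm (f (Sup K) \<bullet> g (Sup K) - f (Inf K) \<bullet> g (Inf K)))
        \<le> B * (\<Sum>K\<in>\<D>. norm (f (Sup K) - f (Inf K))) + A * (\<Sum>K\<in>\<D>. norm (g (Sup K) - g (Inf K)))"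
      by (simp add: sum_distrib_left sum_mono flip: sum.distrib)
    also have "\<dots> < B * (\<epsilon> / (2 * B)) + A * (\<epsilon> / (2 * A))"
      using \<delta>(2)[OF div T] \<delta>'(2)[OF div T] small A(1) B(1)
      by (intro add_strict_mono mult_strict_left_mono) auto
    also have "\<dots> = \<epsilon>" using A(1) B(1) by simp
    finally show ?thesis .
  qed
  then show "\<exists>\<delta>>0. \<forall>\<D> T. \<D> division_of T \<and> T \<subseteq> {a..b} \<and> (\<Sum>K\<in>\<D>. Sup K - Inf K) < \<delta>
       \<longrightarrow> (\<Sum>K\<in>\<D>. norm (f (Sup K) \<bullet> g (Sup K) - f (Inf K) \<bullet> g (Inf K))) < \<epsilon>"
    using \<delta>(1) \<delta>'(1) by (intro exI[of _ "min \<delta> \<delta>'"]) auto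
qed

section \<open>Fundamental theorem of calculus for absolutely continuous functions\<close>

text \<open>
  Tags in the exceptional null set are confined to an open set of small measure, where absolute
  continuity bounds the increments of \<open>f\<close>; at all other tags the derivative controls them.
\<close>
lemma fundamental_theorem_of_calculus_absolutely_continuous:
  fixes f :: "real \<Rightarrow> 'a::banach"
  assumes "a \<le> b" and ac: "absolutely_continuous_on {a..b} f" and N: "negligible N"
    and deriv: "\<And>x. x \<in> {a..b} - N \<Longrightarrow> (f has_vector_derivative f' x) (at x within {a..b})"
  shows "(f' has_integral (f b - f a)) {a..b}"
proof -
  \<comment> \<open>Resetting the integrand to zero on the null set leaves the integral unchanged,
    and reduces the error term at an exceptional tag to an increment of \<open>f\<close>.\<close>
  define h where "h x = (if x \<in> N then 0 else f' x)" for x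
  have "(h has_integral (f b - f a)) {a..b}"
    unfolding has_integral_real
  proof (intro allI impI)
    fix e :: real assume "0 < e"
    \<comment> \<open>The summand 1 keeps the denominator positive for \<open>a = b\<close> and
      makes the bound \<open>c * (b - a) < e / 2\<close> strict.\<close>
    define c where "c = e / (2 * (b - a + 1))"
    have "0 < c" using \<open>0 < e\<close> \<open>a \<le> b\<close> by (simp add: c_def)
    have c: "c * (b - a) < e / 2"
      using \<open>0 < e\<close> \<open>a \<le> b\<close> by (simp add: c_def field_simps)
    obtain \<delta> where \<delta>: "0 < \<delta>"
      "\<And>\<D> T. \<lbrakk>\<D> division_of T; T \<subseteq> {a..b}; (\<Sum>K\<in>\<D>. Sup K - Inf K) < \<delta>\<rbrakk>
        \<Longrightarrow> (\<Sum>K\<in>\<D>. norm (f (Sup K) - f (Inf K))) < e / 2"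
      by (rule absolutely_continuous_onE[OF ac, of "e / 2"]) (use \<open>0 < e\<close> in auto)
    have N_sets: "N \<in> sets lebesgue"
      using N by (auto simp: negligible_iff_null_sets)
    \<comment> \<open>Outer regularity makes \<open>U - N\<close> small; since \<open>N\<close> is
      null, \<open>U\<close> itself has the same measure.\<close>
    obtain U where U: "open U" "N \<subseteq> U" "U - N \<in> lmeasurable" "emeasure lebesgue (U - N) < ennreal \<delta>"
      using sets_lebesgue_outer_open[OF N_sets \<delta>(1)] by blast
    have U_meas: "U \<in> lmeasurable" "measure lebesgue U < \<delta>"
    proof -
      have "negligible N" by fact
      then have "U - N \<union> N \<in> lmeasurable"
        using U(3) negligible_imp_measurable by blast
      moreover have "U - N \<union> N = U" using U(2) by blast
      ultimately show *: "U \<in> lmeasurable" by simp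
      have "emeasure lebesgue U = emeasure lebesgue (U - N)"
        using emeasure_Diff_null_set[of N lebesgue U] N * 
        by (simp add: negligible_iff_null_sets fmeasurableD)
      then show "measure lebesgue U < \<delta>"
        using U(4) * by (simp add: emeasure_eq_measure2 ennreal_less_iff[OF measure_nonneg, symmetric])
    qed
    \<comment> \<open>The membership condition stands inside the existential so that a positive
      radius is chosen at every point, as a gauge requires. Where the condition fails, the radius 1
      serves.\<close>
    have "\<forall>x. \<exists>d>0. x \<in> {a..b} - N \<longrightarrow>
         (\<forall>y\<in>{a..b}. norm (y - x) < d \<longrightarrow> norm (f y - f x - (y - x) *\<^sub>R f' x) \<le> c * norm (y - x))"
      using deriv[unfolded has_vector_derivative_def has_derivative_within_alt] \<open>0 < c\<close>
        zero_less_one by blast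
    then obtain d where d: "\<And>x. 0 < d x"
      "\<And>x y. \<lbrakk>x \<in> {a..b} - N; y \<in> {a..b}; norm (y - x) < d x\<rbrakk>
        \<Longrightarrow> norm (f y - f x - (y - x) *\<^sub>R f' x) \<le> c * norm (y - x)"
      by metis
    define G where "G x = (if x \<in> N then U else ball x (d x))" for x
    have "gauge G"
      using U(1,2) d(1) by (auto simp: gauge_def G_def)
    moreover have "norm ((\<Sum>(x, K)\<in>p. measure lborel K *\<^sub>R h x) - (f b - f a)) < e"
      if p: "p tagged_division_of {a..b}" and fine: "G fine p" for p
    proof -
      define q where "q = {xK \<in> p. fst xK \<in> N}"
      have "finite p" using p by blast
      then have q: "q \<subseteq> p" "finite q" by (auto simp: q_def)
      define E where "E = (\<lambda>(x, K). measure lborel K *\<^sub>R h x - (f (Sup K) - f (Inf K)))"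
      have tag: "x \<in> K \<and> x \<in> {a..b} \<and> K \<subseteq> {a..b} \<and> K \<subseteq> G x \<and> Inf K \<in> K \<and> Sup K \<in> K \<and>
          Inf K \<le> x \<and> x \<le> Sup K \<and> measure lborel K = Sup K - Inf K" if xK: "(x, K) \<in> p" for x K
      proof -
        obtain u v where uv: "K = cbox u v" "x \<in> K" "K \<subseteq> {a..b}"
          using tagged_division_ofD(2-4)[OF p xK] by blast
        moreover have "K \<subseteq> G x" using fine xK by (auto simp: fine_def)
        ultimately show ?thesis by auto
      qed
      have good: "norm (E xK) \<le> c * (Sup (snd xK) - Inf (snd xK))" if "xK \<in> p - q" for xK
      proof -
        obtain x K where xK: "xK = (x, K)" by fastforce
        with that have "(x, K) \<in> p" and "x \<notin> N" by (auto simp: q_def)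
        note K = tag[OF this(1)]
        have "Sup K \<in> ball x (d x)" "Inf K \<in> ball x (d x)" 
          using K \<open>x \<notin> N\<close> by (auto simp: G_def)
        then have "norm (f (Sup K) - f x - (Sup K - x) *\<^sub>R f' x) \<le> c * norm (Sup K - x)"
          "norm (f (Inf K) - f x - (Inf K - x) *\<^sub>R f' x) \<le> c * norm (Inf K - x)"
          using K \<open>x \<notin> N\<close> by (intro d(2); auto simp: dist_norm abs_minus_commute)+
        \<comment> \<open>The error is split at the tag. As the tag lies between the endpoints, the
          two distances to it add up to the length of \<open>K\<close>, so the two linear bounds
          combine to \<open>c\<close> times that length.\<close>
        moreover have "E xK = (f (Inf K) - f x - (Inf K - x) *\<^sub>R f' x)
            - (f (Sup K) - f x - (Sup K - x) *\<^sub>R f' x)"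
        proof -
          have "measure lborel K = Sup K - Inf K" using K by blast
          then have "E xK = (Sup K - Inf K) *\<^sub>R f' x - (f (Sup K) - f (Inf K))"
            using \<open>x \<notin> N\<close> by (simp add: E_def xK h_def)
          then show ?thesis by (simp add: algebra_simps)
        qed
        ultimately have "norm (E xK) \<le> c * norm (Inf K - x) + c * norm (Sup K - x)"
          using norm_triangle_ineq4 by (smt (verit))
        also have "\<dots> = c * (Sup K - Inf K)"
          using K by (simp add: algebra_simps)
        finally show ?thesis by (simp add: xK)
      qed
      have "norm (sum E (p - q)) \<le> (\<Sum>xK\<in>p - q. c * (Sup (snd xK) - Inf (snd xK)))"
        using good by (rule sum_norm_le)
      \<comment> \<open>The omitted terms are nonnegative, so the sum may be enlarged to all of
        \<open>p\<close>, where the lengths telescope to \<open>b - a\<close>.\<close>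
      also have "\<dots> \<le> (\<Sum>xK\<in>p. c * (Sup (snd xK) - Inf (snd xK)))"
        using \<open>finite p\<close> \<open>0 < c\<close> tag by (intro sum_mono2) fastforce+
      also have "\<dots> = c * (b - a)"
        using additive_tagged_division_1[OF \<open>a \<le> b\<close> p, of "\<lambda>x. x"]
        by (simp add: case_prod_unfold flip: sum_distrib_left)
      finally have good_sum: "norm (sum E (p - q)) < e / 2" using c by linarith
      have q_part: "q tagged_partial_division_of {a..b}"
        using p q(1) tagged_partial_division_subset unfolding tagged_division_of_def by blast
      \<comment> \<open>Absolute continuity speaks of divisions without tags, so the tags of
        \<open>q\<close> are dropped. The intervals then cover only the part \<open>?T\<close> of
        \<open>{a..b}\<close>, which lies in \<open>U\<close>.\<close>
      let ?\<D> = "snd ` q" and ?T = "\<Union>(snd ` q)"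
      have div: "?\<D> division_of ?T" using partial_division_of_tagged_division[OF q_part] .
      have qT: "q tagged_division_of ?T" using tagged_partial_division_of_Union_self[OF q_part] .
      have T: "?T \<subseteq> {a..b}" "?T \<subseteq> U"
        using tag q(1) by (fastforce simp: q_def G_def)+
      \<comment> \<open>Non-overlapping intervals have total length equal to the measure of their
        union, which is at most that of \<open>U\<close>.\<close>
      have "(\<Sum>K\<in>?\<D>. Sup K - Inf K) = measure lebesgue ?T"
      proof -
        have "measure lebesgue K = Sup K - Inf K" if "K \<in> ?\<D>" for K
        proof -
          have "measure lebesgue {Inf K..Sup K} = Sup K - Inf K"
            using division_of_real_bounds(3)[OF div that] by simp
          then show ?thesis using division_of_real_bounds(4)[OF div that] by metis
        qed
        then have "(\<Sum>K\<in>?\<D>. Sup K - Inf K) = sum (measure lebesgue) ?\<D>"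
          by simp
        then show ?thesis using content_division[OF div] by simp
      qed
      also have "\<dots> \<le> measure lebesgue U"
        using T(2) U_meas(1) div by (intro measure_mono_fmeasurable) (auto simp: lmeasurable_division fmeasurableD)
      finally have "(\<Sum>K\<in>?\<D>. Sup K - Inf K) < \<delta>" using U_meas(2) by simp
      then have "(\<Sum>K\<in>?\<D>. norm (f (Sup K) - f (Inf K))) < e / 2"
        using \<delta>(2) div T(1) by blast
      moreover have "norm (sum E q) \<le> (\<Sum>(x, K)\<in>q. norm (f (Sup K) - f (Inf K)))"
        by (intro sum_norm_le) (auto simp: E_def q_def h_def norm_minus_commute)
      moreover have "\<dots> = (\<Sum>K\<in>?\<D>. norm (f (Sup K) - f (Inf K)))"
      proof -
        \<comment> \<open>Dropping tags could merge terms, since one interval may carry two tags.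
          Such an interval has empty interior, hence is a single point and contributes zero, so the
          sum is unaffected.\<close>
        have degenerate: "norm (f (Sup K) - f (Inf K)) = 0" if K: "(x, K) \<in> q" "(y, K) \<in> q" "x \<noteq> y" for x y K
        proof -
          have "interior K = {}"
            using tagged_division_ofD(5)[OF qT K(1,2)] K(3) by simp
          moreover obtain u v where "K = {u..v}"
            using tagged_division_ofD(4)[OF qT K(1)] by auto
          moreover have "x \<in> K" 
            using tagged_division_ofD(2)[OF qT K(1)] .
          ultimately have "u = v" "K = {u..v}" by auto
          then show ?thesis by simp
        qed
        have "(\<Sum>K\<in>?\<D>. norm (f (Sup K) - f (Inf K))) = sum ((\<lambda>K. norm (f (Sup K) - f (Inf K))) \<circ> snd) q"
        proof (intro sum.reindex_nontrivial \<open>finite q\<close>)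
          fix xK yK assume "xK \<in> q" "yK \<in> q" "xK \<noteq> yK" "snd xK = snd yK"
          then obtain x y K where "xK = (x, K)" "yK = (y, K)" "(x, K) \<in> q" "(y, K) \<in> q" "x \<noteq> y"
            by (cases xK; cases yK) auto
          then show "norm (f (Sup (snd xK)) - f (Inf (snd xK))) = 0"
            using degenerate[of x K y] by simp
        qed
        then show ?thesis by (simp add: case_prod_unfold)
      qed
      ultimately have bad_sum: "norm (sum E q) < e / 2" by simp
      have "(\<Sum>(x, K)\<in>p. measure lborel K *\<^sub>R h x) - (f b - f a) = sum E p"
        using additive_tagged_division_1[OF \<open>a \<le> b\<close> p, of f]
        by (simp add: E_def case_prod_unfold sum_subtractf)
      also have "\<dots> = sum E (p - q) + sum E q"
        using sum.subset_diff[OF q(1) \<open>finite p\<close>] .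
      also have "norm \<dots> < e"
        using norm_triangle_ineq[of "sum E (p - q)" "sum E q"] good_sum bad_sum by linarith
      finally show ?thesis .
    qed
    ultimately show "\<exists>\<gamma>. gauge \<gamma> \<and> (\<forall>\<D>. \<D> tagged_division_of {a..b} \<and> \<gamma> fine \<D> \<longrightarrow>
        norm ((\<Sum>(x, K)\<in>\<D>. measure lborel K *\<^sub>R h x) - (f b - f a)) < e)"
      by (intro exI[of _ G]) simp
  qed
  then show ?thesis
    by (rule has_integral_spike[OF N, rotated]) (simp add: h_def)
qed

section \<open>Normal and tangent of the circle\<close>

lemma has_vector_derivative_vector_2:
  assumes "(f has_real_derivative f') (at x within S)" "(g has_real_derivative g') (at x within S)"
  shows "((\<lambda>s. vector [f s, g s] :: real^2) has_vector_derivative vector [f', g']) (at x within S)"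
proof -
  \<comment> \<open>Expansion in the standard basis reduces the claim to the derivative rules for
    sums and scalar multiples.\<close>
  have "vector [a, b] = a *\<^sub>R axis 1 1 + b *\<^sub>R (axis 2 1 :: real^2)" for a b :: real
    by (simp add: vec_eq_iff forall_2 axis_def)
  then show ?thesis
    using assms by (auto intro!: derivative_eq_intros)
qed

definition circle_normal :: "real \<Rightarrow> real \<Rightarrow> real^2" where
  "circle_normal r s = vector [cos (s / r), sin (s / r)]"

definition circle_tangent :: "real \<Rightarrow> real \<Rightarrow> real^2" where
  "circle_tangent r s = vector [- sin (s / r), cos (s / r)]"

lemma norm_circle_normal: "norm (circle_normal r s) = 1"
  by (simp add: circle_normal_def norm_eq_sqrt_inner inner_vec_def sum_2 flip: power2_eq_square)

lemma circle_normal_plus_half: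
  assumes "r \<noteq> 0"
  shows "circle_normal r (s + pi * r) = - circle_normal r s"
  using assms by (simp add: circle_normal_def vec_eq_iff forall_2 add_divide_distrib)

lemma circle_tangent_plus_period:
  assumes "r \<noteq> 0"
  shows "circle_tangent r (s + 2 * pi * r) = circle_tangent r s"
  using assms by (simp add: circle_tangent_def vec_eq_iff forall_2 add_divide_distrib)

lemma circle_arclength_has_vector_derivative:
  assumes "r \<noteq> 0"
  shows "(circle_arclength c r has_vector_derivative circle_tangent r s) (at s)"
proof -
  have "((\<lambda>s. vector [cos (s / r), sin (s / r)] :: real^2) has_vector_derivative
      vector [- sin (s / r) / r, cos (s / r) / r]) (at s)"
    using assms by (intro has_vector_derivative_vector_2) (auto intro!: derivative_eq_intros)
  then have "((\<lambda>s. c + r *\<^sub>R vector [cos (s / r), sin (s / r)]) has_vector_derivative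
      0 + r *\<^sub>R vector [- sin (s / r) / r, cos (s / r) / r]) (at s)"
    by (auto intro!: derivative_eq_intros)
  moreover have "0 + r *\<^sub>R vector [- sin (s / r) / r, cos (s / r) / r] = circle_tangent r s"
    using assms by (simp add: circle_tangent_def vec_eq_iff forall_2)
  moreover have "circle_arclength c r = (\<lambda>s. c + r *\<^sub>R vector [cos (s / r), sin (s / r)])"
    by (simp add: fun_eq_iff circle_arclength_def)
  ultimately show ?thesis by simp
qed

text \<open>This is the Frenet relation for curvature \<open>1 / r\<close>; through it the normal
  component of \<open>V\<close> appears when \<open>V s \<bullet> circle_tangent r s\<close> is
  differentiated.\<close>

lemma circle_tangent_has_vector_derivative:
  assumes "r \<noteq> 0"
  shows "(circle_tangent r has_vector_derivative - (1 / r) *\<^sub>R circle_normal r s) (at s)"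
proof -
  have "((\<lambda>s. vector [- sin (s / r), cos (s / r)] :: real^2) has_vector_derivative
      vector [- cos (s / r) / r, - sin (s / r) / r]) (at s)"
    using assms by (intro has_vector_derivative_vector_2) (auto intro!: derivative_eq_intros)
  moreover have "vector [- cos (s / r) / r, - sin (s / r) / r] = - (1 / r) *\<^sub>R circle_normal r s"
    by (simp add: circle_normal_def vec_eq_iff forall_2)
  moreover have "circle_tangent r = (\<lambda>s. vector [- sin (s / r), cos (s / r)])"
    by (simp add: fun_eq_iff circle_tangent_def)
  ultimately show ?thesis by simp
qed

text \<open>The derivative of the tangent has constant norm \<open>1 / r\<close>, so the mean value
  inequality applies. The bound serves to make the tangent, and with it its inner product with
  \<open>V\<close>, absolutely continuous.\<close>

lemma circle_tangent_lipschitz: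
  assumes "r > 0"
  shows "(1 / r)-lipschitz_on UNIV (circle_tangent r)"
proof (rule lipschitz_onI)
  fix x y :: real
  have "norm (circle_tangent r x - circle_tangent r y) \<le> 1 / r * norm (x - y)"
  proof (rule differentiable_bound[where S = UNIV])
    show "(circle_tangent r has_derivative (\<lambda>h. h *\<^sub>R (- (1 / r) *\<^sub>R circle_normal r s))) (at s within UNIV)" for s
      using circle_tangent_has_vector_derivative[of r s] assms
      by (simp add: has_vector_derivative_def)
    show "onorm (\<lambda>h. h *\<^sub>R (- (1 / r) *\<^sub>R circle_normal r s)) \<le> 1 / r" for s
      using assms by (intro onorm_le) (simp add: norm_circle_normal)
  qed auto
  then show "dist (circle_tangent r x) (circle_tangent r y) \<le> 1 / r * dist x y"
    by (simp add: dist_norm)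
qed (use assms in simp)

section \<open>Mean of the normal component of a variation\<close>

text \<open>
  Integrate the derivative of \<open>V \<bullet> T\<close>, with \<open>T\<close> the unit tangent, over a full period:
  the term \<open>V' \<bullet> T\<close> vanishes almost everywhere and \<open>T'\<close> is a multiple of the normal.
\<close>
lemma has_integral_variation_inner_normal:
  assumes "r > 0" and var: "locally_arclength_preserving_variation (2 * pi * r) (circle_arclength c r) V"
  shows "((\<lambda>s. V s \<bullet> circle_normal r s) has_integral 0) {0..2 * pi * r}"
proof -
  let ?L = "2 * pi * r"
  have per: "V (s + ?L) = V s" for s
    using var by (simp add: locally_arclength_preserving_variation_def)
  have ac: "absolutely_continuous_on {0..?L} V"
    and ae: "AE s in lebesgue. \<exists>v g. (V has_vector_derivative v) (at s) \<and>
        (circle_arclength c r has_vector_derivative g) (at s) \<and> v \<bullet> g = 0"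
    using var by (auto simp: locally_arclength_preserving_variation_def)
  obtain N where N: "negligible N"
    "\<And>s. s \<notin> N \<Longrightarrow> \<exists>v g. (V has_vector_derivative v) (at s) \<and>
        (circle_arclength c r has_vector_derivative g) (at s) \<and> v \<bullet> g = 0"
    using AE_E3[OF ae] by (auto simp: negligible_iff_null_sets)
  have "((\<lambda>s. V s \<bullet> circle_tangent r s) has_vector_derivative
      - (1 / r) * (V s \<bullet> circle_normal r s)) (at s within {0..?L})" if s: "s \<in> {0..?L} - N" for s
  proof -
    obtain v g where v: "(V has_vector_derivative v) (at s)" "v \<bullet> g = 0"
      and "(circle_arclength c r has_vector_derivative g) (at s)"
      using N(2)[of s] s by blast
    \<comment> \<open>Uniqueness of derivatives identifies the vector supplied by the variation with
      the tangent, so the term with \<open>v\<close> drops out of the product rule.\<close>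
    then have "g = circle_tangent r s"
      using circle_arclength_has_vector_derivative[of r c s] vector_derivative_unique_at \<open>r > 0\<close> by blast
    then show ?thesis
      using bounded_bilinear.has_vector_derivative[OF bounded_bilinear_inner v(1)
          circle_tangent_has_vector_derivative[of r s]] v(2) \<open>r > 0\<close>
      by (simp add: has_vector_derivative_at_within)
  qed
  moreover have "absolutely_continuous_on {0..?L} (\<lambda>s. V s \<bullet> circle_tangent r s)"
    using ac circle_tangent_lipschitz[OF \<open>r > 0\<close>] lipschitz_on_subset[OF _ subset_UNIV]
      lipschitz_on_imp_absolutely_continuous_on absolutely_continuous_on_inner by metis
  ultimately have "((\<lambda>s. - (1 / r) * (V s \<bullet> circle_normal r s)) has_integral
      (V ?L \<bullet> circle_tangent r ?L - V 0 \<bullet> circle_tangent r 0)) {0..?L}"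
    using \<open>r > 0\<close> N(1) by (intro fundamental_theorem_of_calculus_absolutely_continuous[where N = N]) auto
  \<comment> \<open>The boundary terms cancel because both factors are periodic.\<close>
  moreover have "V ?L \<bullet> circle_tangent r ?L = V 0 \<bullet> circle_tangent r 0"
    using per[of 0] circle_tangent_plus_period[of r 0] \<open>r > 0\<close> by simp
  ultimately have "((\<lambda>s. - (1 / r) * (V s \<bullet> circle_normal r s)) has_integral 0) {0..?L}"
    by simp
  from has_integral_mult_right[OF this, of "- r"] show ?thesis
    using \<open>r > 0\<close> by simp
qed

section \<open>Antipodal distances under a variation\<close>

theorem proposition3p7p19:
  fixes c :: "real^2" and r L :: real and \<gamma> V :: "real \<Rightarrow> real^2"
  assumes "r > 0"
    and "L = 2 * pi * r"
    and "\<gamma> = circle_arclength c r"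
    and "locally_arclength_preserving_variation L \<gamma> V"
    and "\<exists>s0. (V s0 - V (s0 + pi * r)) \<bullet> (\<gamma> s0 - \<gamma> (s0 + pi * r)) > 0"
  shows "\<exists>s1. (V s1 - V (s1 + pi * r)) \<bullet> (\<gamma> s1 - \<gamma> (s1 + pi * r)) < 0"
proof (rule ccontr)
  define P where "P = pi * r"
  define f where "f s = V s \<bullet> circle_normal r s" for s
  define h where "h s = (V s - V (s + P)) \<bullet> (\<gamma> s - \<gamma> (s + P))" for s
  assume "\<not> ?thesis"
  then have nonneg: "h s \<ge> 0" for s by (simp add: h_def P_def not_less)
  have "P > 0" using \<open>r > 0\<close> by (simp add: P_def)
  have L: "L = P + P" using assms(2) by (simp add: P_def)
  have normal: "circle_normal r (s + P) = - circle_normal r s" for s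
    using circle_normal_plus_half[of r s] \<open>r > 0\<close> by (simp add: P_def)
  have \<gamma>: "\<gamma> s = c + r *\<^sub>R circle_normal r s" for s
    by (simp add: assms(3) circle_arclength_def circle_normal_def)
  have chord: "\<gamma> s - \<gamma> (s + P) = (2 * r) *\<^sub>R circle_normal r s" for s
    by (simp add: \<gamma> normal flip: scaleR_add_left)
  have h_fun: "h = (\<lambda>s. 2 * r * (f s + f (s + P)))"
    by (simp add: fun_eq_iff h_def f_def chord normal inner_diff_left)
  have per: "V (s + L) = V s" for s
    using assms(4) by (simp add: locally_arclength_preserving_variation_def)
  have ac: "absolutely_continuous_on {0..L} V"
    using assms(4) by (simp add: locally_arclength_preserving_variation_def)
  have "continuous_on {0..L} (circle_normal r)"
  proof -
    \<comment> \<open>The normal is the circle about the origin scaled to radius 1, so its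
      continuity follows from the differentiability of \<open>circle_arclength\<close>.\<close>
    have "circle_normal r = (\<lambda>s. (1 / r) *\<^sub>R (circle_arclength 0 r s))"
      using \<open>r > 0\<close> by (simp add: fun_eq_iff circle_normal_def circle_arclength_def)
    moreover have "continuous_on {0..L} (circle_arclength 0 r)"
      using \<open>r > 0\<close>
      by (intro continuous_at_imp_continuous_on ballI
          has_vector_derivative_continuous[OF circle_arclength_has_vector_derivative]) simp
    ultimately show ?thesis by (auto intro: continuous_intros)
  qed
  then have cont: "continuous_on {0..L} f"
    unfolding f_def using absolutely_continuous_on_imp_continuous_on[OF ac] by (intro continuous_intros)
  have cont1: "continuous_on {0..P} f"
    using cont by (rule continuous_on_subset) (use L \<open>P > 0\<close> in auto)
  have cont2: "continuous_on {0..P} (f \<circ> (\<lambda>s. s + P))"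
    by (intro continuous_on_compose continuous_intros continuous_on_subset[OF cont]) (use L in auto)
  have "(f has_integral 0) {0..L}"
    unfolding f_def using has_integral_variation_inner_normal[of r c V] assms(1-4) by simp
  \<comment> \<open>The full period is cut at \<open>P\<close> and its second half shifted back onto
    \<open>{0..P}\<close>. The integrand becomes \<open>f s + f (s + P)\<close>, which is
    \<open>h s\<close> up to the factor \<open>2 * r\<close>.\<close>
  then have "0 = integral {0..P} f + integral {P..L} f"
    using Henstock_Kurzweil_Integration.integral_combine[of 0 P L f] L \<open>P > 0\<close>
    by (simp add: has_integral_integrable integral_unique)
  also have "integral {P..L} f = integral {0..P} (f \<circ> (\<lambda>s. s + P))"
    using integral_shift[of 0 P P f] continuous_on_subset[OF cont] L \<open>P > 0\<close> by simp
  also have "integral {0..P} f + \<dots> = integral {0..P} (\<lambda>s. f s + f (s + P))"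
    using integral_add[OF integrable_continuous_real[OF cont1] integrable_continuous_real[OF cont2]]
    by (simp add: comp_def)
  finally have "integral {0..P} h = 0"
    by (simp add: h_fun)
  moreover have "continuous_on {0..P} h"
    unfolding h_fun using cont1 cont2 by (intro continuous_intros) (auto simp: comp_def)
  \<comment> \<open>A continuous nonnegative function with zero integral vanishes identically, here
    on one half period.\<close>
  ultimately have zero: "h s = 0" if "s \<in> {0..P}" for s
    using integral_eq_0_iff[of 0 P h] nonneg \<open>P > 0\<close> that by blast
  \<comment> \<open>Exchanging the antipodal points reverses the sign of both factors, so
    \<open>h\<close> has period \<open>P\<close>, half that of \<open>V\<close>. This spreads the
    vanishing from \<open>{0..P}\<close> to the whole line.\<close>
  interpret periodic_fun_simple h P
  proof
    fix s
    have "V (s + P + P) = V s" using per[of s] L by (simp add: add.assoc)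
    then have "h (s + P) = (V (s + P) - V s) \<bullet> ((2 * r) *\<^sub>R - circle_normal r s)"
      by (simp only: h_def chord normal)
    then show "h (s + P) = h s"
      by (simp add: h_def chord inner_diff_left right_diff_distrib)
  qed
  obtain s0 where "h s0 > 0" using assms(5) by (auto simp: h_def P_def)
  moreover have "h s0 = h (s0 - of_int \<lfloor>s0 / P\<rfloor> * P)"
    by (simp add: minus_of_int)
  \<comment> \<open>Subtracting \<open>\<lfloor>s0 / P\<rfloor>\<close> periods moves
    \<open>s0\<close> into \<open>{0..P}\<close>, where \<open>h\<close> is zero.\<close>
  moreover have "s0 - of_int \<lfloor>s0 / P\<rfloor> * P \<in> {0..P}"
    using floor_divide_lower[OF \<open>P > 0\<close>, of s0] floor_divide_upper[OF \<open>P > 0\<close>, of s0]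
    by (simp add: algebra_simps)
  ultimately show False using zero by simp
qed

end
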